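(* Let $n,m\in\mathbb N$ and let $(\mathbf d,w)\in\mathbb N^m\times\mathbb R_{>0}^m$ be a normalized pair, i.e. $M:=\sum_{i=1}^m d_i\ge n$ and $\sum_{i=1}^m w_i^2 d_i=1$. Let $\mathcal W_w=(w_i,W_i)_{i=1}^m$ be a tight fusion frame for $\mathbb C^n$ with $\dim W_i=d_i$ for every $i$, so that $S_{\mathcal W_w}=\frac1n I_n$. If $i\in\{1,\dots,m\}$ is an index such that $M-d_i=\sum_{k\ne i}d_k\le n-1$, then $w_i^2=\frac1n$ and $P_{W_i}P_{W_j}=0$ for every $j\in\{1,\dots,m\}\setminus\{i\}$.
   Context: For a subspace $W\subseteq\mathbb C^n$, $P_W$ denotes the orthogonal projection onto $W$. For subspaces $W_1,\dots,W_m$ of $\mathbb C^n$ and weights $w\in\mathbb R_{>0}^m$, the frame operator of $\mathcal W_w=(w_i,W_i)_{i=1}^m$ is $S_{\mathcal W_w}=\sum_{i=1}^m w_i^2P_{W_i}$. $\mathcal W_w$ is a fusion frame if $S_{\mathcal W_w}$ is invertible, and a tight fusion frame if $S_{\mathcal W_w}=A\,I_n$ for some $A>0$. Here $\mathbb N$ is the set of positive integers. *)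

theory Defs
  imports "HOL-Analysis.Analysis"
begin

definition hinner :: "complex ^ 'n \<Rightarrow> complex ^ 'n \<Rightarrow> complex" where
  "hinner x y = (\<Sum>k\<in>UNIV. x $ k * cnj (y $ k))"

(* Subspaces of C^n are complex subspaces, i.e. vec.subspace (scalar action *s) with dimension
   vec.dim; the unqualified subspace and dim would be the real ones. The description is
   well defined for such W, see orth_proj_ex1. *)
definition orth_proj :: "(complex ^ 'n) set \<Rightarrow> complex ^ 'n \<Rightarrow> complex ^ 'n" where
  "orth_proj W x = (THE y. y \<in> W \<and> (\<forall>u\<in>W. hinner (x - y) u = 0))"

definition frame_operator ::
    "nat \<Rightarrow> (nat \<Rightarrow> real) \<Rightarrow> (nat \<Rightarrow> (complex ^ 'n) set) \<Rightarrow> complex ^ 'n \<Rightarrow> complex ^ 'n" where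
  "frame_operator m w W x = (\<Sum>i\<in>{1..m}. (w i)\<^sup>2 *\<^sub>R orth_proj (W i) x)"

definition tight_fusion_frame ::
    "nat \<Rightarrow> (nat \<Rightarrow> real) \<Rightarrow> (nat \<Rightarrow> (complex ^ 'n) set) \<Rightarrow> bool" where
  "tight_fusion_frame m w W \<longleftrightarrow>
     (\<forall>i\<in>{1..m}. 0 < w i \<and> vec.subspace (W i)) \<and>
     (\<exists>A>0. frame_operator m w W = (\<lambda>x. A *\<^sub>R x))"

definition normalized_pair :: "nat \<Rightarrow> nat \<Rightarrow> (nat \<Rightarrow> nat) \<Rightarrow> (nat \<Rightarrow> real) \<Rightarrow> bool" where
  "normalized_pair n m d w \<longleftrightarrow>
     (\<forall>i\<in>{1..m}. 0 < d i \<and> 0 < w i) \<and>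
     n \<le> (\<Sum>i\<in>{1..m}. d i) \<and>
     (\<Sum>i\<in>{1..m}. (w i)\<^sup>2 * real (d i)) = 1"

lemma Re_hinner: "Re (hinner x y) = x \<bullet> y"
  by (simp add: hinner_def inner_vec_def inner_complex_def)

lemma hinner_scale_right: "hinner x (c *s y) = cnj c * hinner x y"
  by (simp add: hinner_def sum_distrib_left mult_ac)

lemma hinner_diff_left: "hinner (x - y) z = hinner x z - hinner y z"
  by (simp add: hinner_def left_diff_distrib sum_subtractf)

lemma orth_proj_ex1:
  fixes W :: "(complex ^ 'n) set"
  assumes W: "vec.subspace W"
  shows "\<exists>!y. y \<in> W \<and> (\<forall>u\<in>W. hinner (x - y) u = 0)"
proof -
  have scaleR: "r *\<^sub>R v = of_real r *s v" for r and v :: "complex ^ 'n"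
    by (simp add: vec_eq_iff scaleR_conv_of_real[where 'a = complex])
  have "subspace W"
    unfolding subspace_def scaleR
    using W by (simp add: vec.subspace_def)
  then have span: "span W = W"
    by (simp add: span_eq_iff)
  obtain y z where y: "y \<in> W" and z: "\<And>u. u \<in> W \<Longrightarrow> orthogonal z u" and x: "x = y + z"
    using orthogonal_subspace_decomp_exists[of W x] span by metis
  have "hinner (x - y) u = 0" if u: "u \<in> W" for u
  proof (rule complex_eqI)
    show "Re (hinner (x - y) u) = Re 0"
      using z[OF u] x by (simp add: Re_hinner orthogonal_def)
    have "\<i> *s u \<in> W"
      using W u by (simp add: vec.subspace_def)
    then have "Re (hinner (x - y) (\<i> *s u)) = 0"
      using z x by (simp add: Re_hinner orthogonal_def)
    then show "Im (hinner (x - y) u) = Im 0"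
      by (simp add: hinner_scale_right)
  qed
  then show ?thesis
  proof (intro ex1I[of _ y] conjI ballI)
    fix y' assume y': "y' \<in> W \<and> (\<forall>u\<in>W. hinner (x - y') u = 0)"
    assume orth: "\<And>u. u \<in> W \<Longrightarrow> hinner (x - y) u = 0"
    have d: "y' - y \<in> W"
      using W y y' by (simp add: vec.subspace_diff)
    have "hinner (y' - y) (y' - y) = hinner (x - y) (y' - y) - hinner (x - y') (y' - y)"
      by (simp add: hinner_diff_left)
    also have "\<dots> = 0"
      using d y' orth by simp
    finally have "(y' - y) \<bullet> (y' - y) = 0"
      by (metis Re_hinner zero_complex.simps(1))
    then show "y' = y"
      by simp
  qed (use y in auto)
qed

end

theory Submission imports Defs begin

text \<open>
  Write \<open>P i\<close> for the projection onto \<open>W i\<close> and \<open>S = (\<Sum>i. (w i)\<^sup>2 P i) = A I\<close>. The trace of a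
  projection is the dimension of its range, so \<open>n A = (\<Sum>i. (w i)\<^sup>2 d i) = 1\<close>, which gives
  \<open>A = 1 / n\<close>. If the dimensions of the \<open>W k\<close> with \<open>k \<noteq> i\<close> add up to less than \<open>n\<close>, some \<open>x \<noteq> 0\<close> is
  orthogonal to all of them, and \<open>A x = S x = (w i)\<^sup>2 P i x\<close>. Hence \<open>x\<close> lies in \<open>W i\<close>, so \<open>P i x = x\<close>
  and \<open>(w i)\<^sup>2 = A\<close>. For every \<open>y\<close> in \<open>W i\<close> it follows that
  \<open>A \<parallel>y\<parallel>\<^sup>2 = S y \<bullet> y = A \<parallel>y\<parallel>\<^sup>2 + (\<Sum>k\<noteq>i. (w k)\<^sup>2 \<parallel>P k y\<parallel>\<^sup>2)\<close>, so every \<open>P k\<close> with \<open>k \<noteq> i\<close> vanishes on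
  \<open>W i\<close>; taking adjoints, \<open>P i P k = 0\<close>.

  Everything is carried out in the underlying real Euclidean space, with the real inner product
  \<open>Re (hinner x y) = x \<bullet> y\<close>: a complex subspace has the same orthogonal projection there, and its
  real dimension is twice its complex dimension (\<open>dim_eq_twice_vec_dim\<close>), so that all traces and
  dimension counts are doubled. The trace formula is \<open>trace_orth_proj\<close>, and the vector \<open>x\<close> comes
  from \<open>exists_orthogonal_to_subspaces\<close>.
\<close>

lemma scaleR_eq_scalar_mult:
  fixes v :: "complex ^ 'n"
  shows "r *\<^sub>R v = of_real r *s v"
  by (simp add: vec_eq_iff scaleR_conv_of_real[where 'a = complex])

lemma subspace_if_vec_subspace:
  fixes W :: "(complex ^ 'n) set"
  assumes "vec.subspace W"
  shows "subspace W"
  using assms by (simp add: subspace_def vec.subspace_def scaleR_eq_scalar_mult)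

text \<open>Adding \<open>b\<close> to a complex basis adds the two real dimensions spanned by \<open>b\<close> and \<open>\<i> *s b\<close>.\<close>

lemma dim_vec_span_independent:
  fixes B :: "(complex ^ 'n) set"
  assumes "finite B" "vec.independent B"
  shows "dim (vec.span B) = 2 * card B"
  using assms
proof (induction B rule: finite_induct)
  case empty
  then show ?case by simp
next
  case (insert b B)
  let ?V = "vec.span B"
  have b: "b \<notin> ?V" and IH: "dim ?V = 2 * card B"
    using insert by (simp_all add: vec.independent_insert)
  have V: "span ?V = ?V"
    by (simp add: span_eq_iff subspace_if_vec_subspace)
  have mult: "c = 0" if "c *s b \<in> ?V" for c
    using b vec.span_scale[OF that, of "inverse c"] by (cases "c = 0") simp_all
  have ib: "\<i> *s b \<notin> span ?V"
    using mult[of \<i>] unfolding V by auto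
  have b': "b \<notin> span (insert (\<i> *s b) ?V)"
  proof
    assume "b \<in> span (insert (\<i> *s b) ?V)"
    then obtain r where "b - r *\<^sub>R (\<i> *s b) \<in> ?V"
      using V span_breakdown_eq[of b "\<i> *s b" ?V] by auto
    moreover have "b - r *\<^sub>R (\<i> *s b) = (1 - of_real r * \<i>) *s b"
      by (simp add: scaleR_eq_scalar_mult algebra_simps vec.scale_left_diff_distrib)
    ultimately have "1 - of_real r * \<i> = 0"
      using mult by metis
    then show False by (simp add: complex_eq_iff)
  qed
  have "span (insert b (insert (\<i> *s b) ?V)) = vec.span (insert b B)"
  proof
    have "insert b (insert (\<i> *s b) ?V) \<subseteq> vec.span (insert b B)"
      by (auto intro: vec.span_base vec.span_scale vec.span_mono[THEN subsetD, of B])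
    then show "span (insert b (insert (\<i> *s b) ?V)) \<subseteq> vec.span (insert b B)"
      by (simp add: span_minimal subspace_if_vec_subspace)
  next
    show "vec.span (insert b B) \<subseteq> span (insert b (insert (\<i> *s b) ?V))"
    proof
      fix v assume "v \<in> vec.span (insert b B)"
      then obtain c where c: "v - c *s b \<in> ?V"
        by (auto simp: vec.span_breakdown_eq)
      have "v = Re c *\<^sub>R b + Im c *\<^sub>R (\<i> *s b) + (v - c *s b)"
        by (simp add: vec_eq_iff complex_eq_iff)
      also have "\<dots> \<in> span (insert b (insert (\<i> *s b) ?V))"
        using c by (intro span_add span_scale) (auto intro: span_base)
      finally show "v \<in> span (insert b (insert (\<i> *s b) ?V))" .
    qed
  qed
  then have "dim (vec.span (insert b B)) = dim (insert b (insert (\<i> *s b) ?V))"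
    by (metis dim_span)
  also have "\<dots> = 2 * card (insert b B)"
    using ib b' IH insert.hyps by (simp add: dim_insert)
  finally show ?case .
qed

lemma dim_eq_twice_vec_dim:
  fixes W :: "(complex ^ 'n) set"
  assumes "vec.subspace W"
  shows "dim W = 2 * vec.dim W"
proof -
  obtain B where B: "B \<subseteq> W" "vec.independent B" "W \<subseteq> vec.span B" "card B = vec.dim W"
    using vec.basis_exists by blast
  have "vec.span B = W"
    using B assms by (metis vec.span_subspace)
  then show ?thesis
    using dim_vec_span_independent[of B] B vec.finiteI_independent by auto
qed

lemma orth_proj_mem:
  assumes "vec.subspace W"
  shows "orth_proj W x \<in> W"
  using theI'[OF orth_proj_ex1[OF assms, of x]] by (simp add: orth_proj_def)

lemma orth_proj_orthogonal:
  assumes "vec.subspace W" "u \<in> W"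
  shows "(x - orth_proj W x) \<bullet> u = 0"
proof -
  have "hinner (x - orth_proj W x) u = 0"
    using theI'[OF orth_proj_ex1[OF assms(1), of x]] assms(2) by (simp add: orth_proj_def)
  then show ?thesis
    by (metis Re_hinner zero_complex.simps(1))
qed

text \<open>Orthogonality in the real inner product already characterises the projection.\<close>

lemma orth_proj_eqI:
  assumes W: "vec.subspace W" and y: "y \<in> W" and orth: "\<And>u. u \<in> W \<Longrightarrow> (x - y) \<bullet> u = 0"
  shows "orth_proj W x = y"
proof -
  let ?p = "orth_proj W x"
  have u: "?p - y \<in> W"
    using W y by (simp add: orth_proj_mem vec.subspace_diff)
  have "(?p - y) \<bullet> (?p - y) = (x - y) \<bullet> (?p - y) - (x - ?p) \<bullet> (?p - y)"
    by (simp add: algebra_simps)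
  also have "\<dots> = 0"
    using orth[OF u] orth_proj_orthogonal[OF W u] by simp
  finally show ?thesis by simp
qed

lemma orth_proj_fixed:
  assumes "vec.subspace W" "x \<in> W"
  shows "orth_proj W x = x"
  using assms by (intro orth_proj_eqI) auto

lemma orth_proj_eq_0:
  assumes "vec.subspace W" "\<And>u. u \<in> W \<Longrightarrow> x \<bullet> u = 0"
  shows "orth_proj W x = 0"
  using assms by (intro orth_proj_eqI) (auto simp: vec.subspace_0)

lemma inner_orth_proj_right:
  assumes "vec.subspace W"
  shows "orth_proj W x \<bullet> orth_proj W y = x \<bullet> orth_proj W y"
  using orth_proj_orthogonal[OF assms orth_proj_mem[OF assms], of x y]
  by (simp add: inner_diff_left)

lemma orth_proj_self_adjoint:
  assumes "vec.subspace W"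
  shows "orth_proj W x \<bullet> y = x \<bullet> orth_proj W y"
  using inner_orth_proj_right[OF assms, of x y] inner_orth_proj_right[OF assms, of y x]
  by (simp add: inner_commute)

lemma inner_orth_proj_self:
  assumes "vec.subspace W"
  shows "orth_proj W x \<bullet> x = (norm (orth_proj W x))\<^sup>2"
  using inner_orth_proj_right[OF assms, of x x]
  by (simp add: power2_norm_eq_inner inner_commute)

text \<open>If \<open>B\<close> is a real orthonormal basis of \<open>W\<close>, then \<open>(\<Sum>e. P e \<bullet> e) = (\<Sum>b\<in>B. \<parallel>b\<parallel>\<^sup>2)\<close>.\<close>

lemma trace_orth_proj:
  fixes W :: "(complex ^ 'n) set"
  assumes W: "vec.subspace W"
  shows "(\<Sum>e\<in>Basis. orth_proj W e \<bullet> e) = 2 * real (vec.dim W)"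
proof -
  obtain B where B: "B \<subseteq> W" "pairwise orthogonal B" "\<And>b. b \<in> B \<Longrightarrow> norm b = 1"
      "independent B" "card B = dim W" "span B = W"
    using orthonormal_basis_subspace[OF subspace_if_vec_subspace[OF W]] by blast
  have fin: "finite B"
    using B(4) by (rule independent_imp_finite)
  have bb: "b \<bullet> c = (if b = c then 1 else 0)" if "b \<in> B" "c \<in> B" for b c
    using that B(2,3) by (auto simp: pairwise_def orthogonal_def norm_eq_1)
  have P: "orth_proj W x = (\<Sum>b\<in>B. (x \<bullet> b) *\<^sub>R b)" for x
  proof (rule orth_proj_eqI[OF W])
    show "(\<Sum>b\<in>B. (x \<bullet> b) *\<^sub>R b) \<in> W"
      unfolding B(6)[symmetric] by (intro span_sum span_scale span_base)
    fix u assume "u \<in> W"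
    then have "u \<in> span B"
      by (simp add: B(6))
    then show "(x - (\<Sum>b\<in>B. (x \<bullet> b) *\<^sub>R b)) \<bullet> u = 0"
    proof (induction rule: span_induct_alt)
      case (step c b v)
      have "(\<Sum>a\<in>B. (x \<bullet> a) * (a \<bullet> b)) = (\<Sum>a\<in>B. if a = b then x \<bullet> a else 0)"
        using step(1) by (intro sum.cong) (simp_all add: bb)
      also have "\<dots> = x \<bullet> b"
        using step(1) fin by simp
      finally show ?case
        using step by (simp add: inner_add_right inner_diff_left inner_sum_left)
    qed simp
  qed
  have "(\<Sum>e\<in>Basis. orth_proj W e \<bullet> e) = (\<Sum>e\<in>Basis. \<Sum>b\<in>B. (b \<bullet> e) * (b \<bullet> e))"
    by (simp add: P inner_sum_left inner_sum_right inner_commute)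
  also have "\<dots> = (\<Sum>b\<in>B. \<Sum>e\<in>Basis. (b \<bullet> e) * (b \<bullet> e))"
    by (rule sum.swap)
  also have "\<dots> = (\<Sum>b\<in>B. 1)"
    using bb by (intro sum.cong) (simp_all add: euclidean_inner[symmetric])
  also have "\<dots> = 2 * real (vec.dim W)"
    using B(5) dim_eq_twice_vec_dim[OF W] by simp
  finally show ?thesis .
qed

lemma exists_orthogonal_to_subspaces:
  fixes W :: "'i \<Rightarrow> 'a::euclidean_space set"
  assumes "finite K" "(\<Sum>k\<in>K. dim (W k)) < DIM('a)"
  obtains x where "x \<noteq> 0" "\<And>k u. k \<in> K \<Longrightarrow> u \<in> W k \<Longrightarrow> x \<bullet> u = 0"
proof -
  have "\<exists>B. independent B \<and> W k \<subseteq> span B \<and> card B = dim (W k)" for k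
    using basis_exists[of "W k"] by metis
  then obtain B where B: "\<And>k. independent (B k)" "\<And>k. W k \<subseteq> span (B k)"
      "\<And>k. card (B k) = dim (W k)"
    by metis
  let ?T = "\<Union>k\<in>K. B k"
  have "dim ?T \<le> card ?T"
    using assms(1) B(1) independent_imp_finite by (intro dim_le_card') auto
  also have "\<dots> \<le> (\<Sum>k\<in>K. dim (W k))"
    using card_UN_le[OF assms(1), of B] by (simp add: B(3))
  finally have "dim ?T < DIM('a)"
    using assms(2) by simp
  then obtain x where x: "x \<noteq> 0" "\<And>y. y \<in> span ?T \<Longrightarrow> orthogonal x y"
    using orthogonal_to_subspace_exists by blast
  have "x \<bullet> u = 0" if "k \<in> K" "u \<in> W k" for k u
  proof -
    have "u \<in> span ?T"
      using that B(2)[of k] span_mono[of "B k" ?T] by blast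
    then show ?thesis
      using x(2) by (simp add: orthogonal_def)
  qed
  with x(1) show thesis
    using that by blast
qed

theorem proposition3p1p1:
  fixes m :: nat
    and d :: "nat \<Rightarrow> nat"
    and w :: "nat \<Rightarrow> real"
    and W :: "nat \<Rightarrow> (complex ^ 'n) set"
  assumes "1 \<le> m"
    and "normalized_pair CARD('n) m d w"
    and "tight_fusion_frame m w W"
    and "\<forall>i\<in>{1..m}. vec.dim (W i) = d i"
  shows "frame_operator m w W = (\<lambda>x. (1 / real CARD('n)) *\<^sub>R x) \<and>
    (\<forall>i\<in>{1..m}. (\<Sum>k\<in>{1..m} - {i}. d k) \<le> CARD('n) - 1 \<longrightarrow>
       (w i)\<^sup>2 = 1 / real CARD('n) \<and>
       (\<forall>j\<in>{1..m} - {i}. orth_proj (W i) \<circ> orth_proj (W j) = (\<lambda>x. 0)))"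
proof -
  define n where "n = real CARD('n)"
  have n: "n > 0"
    by (simp add: n_def)
  have sub: "vec.subspace (W i)" and wpos: "w i > 0" and dimW: "vec.dim (W i) = d i"
    if "i \<in> {1..m}" for i
    using that assms by (auto simp: tight_fusion_frame_def)
  obtain A where A: "A > 0" "frame_operator m w W = (\<lambda>x. A *\<^sub>R x)"
    using assms(3) by (auto simp: tight_fusion_frame_def)
  have S: "(\<Sum>i\<in>{1..m}. (w i)\<^sup>2 *\<^sub>R orth_proj (W i) x) = A *\<^sub>R x" for x
    using fun_cong[OF A(2), of x] by (simp add: frame_operator_def)

  \<comment> \<open>Both sides compute the real trace of the frame operator.\<close>
  have "2 * n * A = (\<Sum>e\<in>(Basis :: (complex ^ 'n) set). (A *\<^sub>R e) \<bullet> e)"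
    by (simp add: n_def)
  also have "\<dots> = (\<Sum>e\<in>Basis. \<Sum>i\<in>{1..m}. (w i)\<^sup>2 * (orth_proj (W i) e \<bullet> e))"
    by (simp only: S[symmetric] inner_sum_left inner_scaleR_left)
  also have "\<dots> = (\<Sum>i\<in>{1..m}. (w i)\<^sup>2 * (\<Sum>e\<in>Basis. orth_proj (W i) e \<bullet> e))"
    by (subst sum.swap) (simp add: sum_distrib_left)
  also have "\<dots> = (\<Sum>i\<in>{1..m}. 2 * ((w i)\<^sup>2 * real (d i)))"
    using sub dimW by (intro sum.cong) (simp_all add: trace_orth_proj)
  also have "\<dots> = 2"
    using assms(2) by (simp add: normalized_pair_def sum_distrib_left[symmetric])
  finally have A_eq: "A = 1 / n"
    using n by (simp add: field_simps)

  have "(w i)\<^sup>2 = A \<and> (\<forall>j\<in>{1..m} - {i}. orth_proj (W i) \<circ> orth_proj (W j) = (\<lambda>x. 0))"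
    if i: "i \<in> {1..m}" and less: "(\<Sum>k\<in>{1..m} - {i}. d k) \<le> CARD('n) - 1" for i
  proof -
    let ?K = "{1..m} - {i}"
    have split: "A *\<^sub>R x = (w i)\<^sup>2 *\<^sub>R orth_proj (W i) x +
        (\<Sum>k\<in>?K. (w k)\<^sup>2 *\<^sub>R orth_proj (W k) x)" for x
      using i by (simp add: S[symmetric] sum.remove)
    have "(\<Sum>k\<in>?K. dim (W k)) = (\<Sum>k\<in>?K. 2 * d k)"
      using sub dimW by (intro sum.cong) (simp_all add: dim_eq_twice_vec_dim)
    also have "\<dots> = 2 * (\<Sum>k\<in>?K. d k)"
      by (simp add: sum_distrib_left)
    also have "\<dots> \<le> 2 * (CARD('n) - 1)"
      using less by simp
    also have "\<dots> < 2 * CARD('n)"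
      by simp
    also have "\<dots> = DIM(complex ^ 'n)"
      by simp
    finally obtain x where x: "x \<noteq> 0" "\<And>k u. k \<in> ?K \<Longrightarrow> u \<in> W k \<Longrightarrow> x \<bullet> u = 0"
      using exists_orthogonal_to_subspaces[of ?K W] by blast
    have "orth_proj (W k) x = 0" if "k \<in> ?K" for k
      using that sub x(2) by (intro orth_proj_eq_0) auto
    then have eigen: "A *\<^sub>R x = (w i)\<^sup>2 *\<^sub>R orth_proj (W i) x"
      by (simp add: split)
    have "x = inverse A *\<^sub>R (A *\<^sub>R x)"
      using A(1) by simp
    also have "\<dots> = ((w i)\<^sup>2 / A) *\<^sub>R orth_proj (W i) x"
      unfolding eigen by (simp add: divide_inverse mult.commute)
    finally have "x = ((w i)\<^sup>2 / A) *\<^sub>R orth_proj (W i) x" .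
    moreover have "((w i)\<^sup>2 / A) *\<^sub>R orth_proj (W i) x \<in> W i"
      using i sub orth_proj_mem subspace_if_vec_subspace subspace_scale by blast
    ultimately have "x \<in> W i"
      by simp
    then have "A *\<^sub>R x = (w i)\<^sup>2 *\<^sub>R x"
      using eigen sub[OF i] by (simp add: orth_proj_fixed)
    then have w_eq: "(w i)\<^sup>2 = A"
      using x(1) by simp

    have vanish: "orth_proj (W j) y = 0" if j: "j \<in> ?K" and y: "y \<in> W i" for j y
    proof -
      have "(\<Sum>k\<in>?K. (w k)\<^sup>2 *\<^sub>R orth_proj (W k) y) = 0"
        using split[of y] y sub[OF i] w_eq by (simp add: orth_proj_fixed)
      then have "0 = (\<Sum>k\<in>?K. (w k)\<^sup>2 *\<^sub>R orth_proj (W k) y) \<bullet> y"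
        by simp
      also have "\<dots> = (\<Sum>k\<in>?K. (w k)\<^sup>2 * (norm (orth_proj (W k) y))\<^sup>2)"
        using sub by (simp add: inner_sum_left inner_orth_proj_self)
      finally have "(w j)\<^sup>2 * (norm (orth_proj (W j) y))\<^sup>2 = 0"
        using j sum_nonneg_eq_0_iff[of ?K "\<lambda>k. (w k)\<^sup>2 * (norm (orth_proj (W k) y))\<^sup>2"] by simp
      then show ?thesis
        using wpos[of j] j by simp
    qed
    have "orth_proj (W i) (orth_proj (W j) z) = 0" if j: "j \<in> ?K" for j z
    proof -
      let ?v = "orth_proj (W i) (orth_proj (W j) z)"
      have "?v \<bullet> ?v = z \<bullet> orth_proj (W j) (orth_proj (W i) ?v)"
        using i j sub by (simp add: orth_proj_self_adjoint)
      also have "\<dots> = 0"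
        using vanish[OF j] i sub by (simp add: orth_proj_mem)
      finally show ?thesis by simp
    qed
    then show ?thesis
      using w_eq by (simp add: fun_eq_iff)
  qed
  then show ?thesis
    using A(2) A_eq by (simp add: n_def)
qed

end
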